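(* Let $\Gamma$ be a Kleinian group, i.e. a discrete subgroup of $\mathrm{PSL}(2,\mathbb{C})$ (possibly with involutions), and let $g$ be an element of $\Gamma$. Then the following statements are equivalent: (1) $g$ is reversible in $\Gamma$; (2) $g$ is strongly reversible in $\Gamma$.
   Context: An element $g$ of a group $G$ is called reversible if it is conjugate to its inverse in $G$, i.e. there exists $h\in G$ such that $hgh^{-1}=g^{-1}$. If such a conjugating element $h\in G$ can be chosen to be an involution, then $g$ is called strongly reversible.
   Formalization: The identity is counted as an involution here; with involutions of order exactly 2 the claim fails for g = 1 when Γ has no involutions (e.g. the trivial group), while for g ≠ 1 the two readings agree. *)

theory Defs
  imports "HOL-Analysis.Analysis" "HOL-Algebra.Coset"
begin

definition SL2C :: "(complex^2^2) monoid" where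
  "SL2C = \<lparr>carrier = {A. det A = 1}, mult = (**), one = mat 1\<rparr>"

definition SL2C_centre :: "(complex^2^2) set" where
  "SL2C_centre = {mat 1, - mat 1}"

definition PSL2C :: "(complex^2^2) set monoid" where
  "PSL2C = SL2C Mod SL2C_centre"

definition PSL2C_proj :: "complex^2^2 \<Rightarrow> (complex^2^2) set" where
  "PSL2C_proj A = SL2C_centre #>\<^bsub>SL2C\<^esub> A"

text \<open>The quotient of the topology that \<open>SL(2,\<complex>)\<close> inherits from the space of complex matrices;
  see \<open>quotient_map_PSL2C_proj\<close> below.\<close>

definition PSL2C_topology :: "(complex^2^2) set topology" where
  "PSL2C_topology = topology (\<lambda>U. U \<subseteq> carrier PSL2C \<and>
     openin (top_of_set (carrier SL2C)) {A \<in> carrier SL2C. PSL2C_proj A \<in> U})"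

definition Kleinian_group :: "(complex^2^2) set set \<Rightarrow> bool" where
  "Kleinian_group \<Gamma> \<longleftrightarrow>
     subgroup \<Gamma> PSL2C \<and> subtopology PSL2C_topology \<Gamma> = discrete_topology \<Gamma>"

definition reversible :: "('a, 'b) monoid_scheme \<Rightarrow> 'a \<Rightarrow> bool" where
  "reversible G g \<longleftrightarrow>
     g \<in> carrier G \<and> (\<exists>h\<in>carrier G. h \<otimes>\<^bsub>G\<^esub> g \<otimes>\<^bsub>G\<^esub> inv\<^bsub>G\<^esub> h = inv\<^bsub>G\<^esub> g)"

text \<open>As is usual in the theory of reversibility, the identity counts as an involution. The choice
  affects strong reversibility of \<open>g\<close> only for \<open>g = \<one>\<close>: if \<open>h = \<one>\<close> conjugates \<open>g \<noteq> \<one>\<close>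
  to its inverse, then \<open>g\<close> has order 2 and may itself be used as the conjugating element.
  Requiring order exactly 2 would make \<open>\<one>\<close> reversible but not strongly reversible in every
  group without elements of order 2.\<close>

definition involution :: "('a, 'b) monoid_scheme \<Rightarrow> 'a \<Rightarrow> bool" where
  "involution G h \<longleftrightarrow> h \<in> carrier G \<and> h \<otimes>\<^bsub>G\<^esub> h = \<one>\<^bsub>G\<^esub>"

definition strongly_reversible :: "('a, 'b) monoid_scheme \<Rightarrow> 'a \<Rightarrow> bool" where
  "strongly_reversible G g \<longleftrightarrow>
     g \<in> carrier G \<and> (\<exists>h. involution G h \<and> h \<otimes>\<^bsub>G\<^esub> g \<otimes>\<^bsub>G\<^esub> inv\<^bsub>G\<^esub> h = inv\<^bsub>G\<^esub> g)"

lemma group_SL2C: "group SL2C"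
proof (rule groupI)
  fix A assume A: "A \<in> carrier SL2C"
  then have "invertible A"
    by (simp add: SL2C_def invertible_det_nz)
  then obtain B where B: "B ** A = mat 1"
    by (auto simp: invertible_def)
  have "det B * det A = det (mat 1 :: complex^2^2)"
    by (metis B det_mul)
  then have "det B = 1"
    using A by (simp add: SL2C_def)
  then show "\<exists>B\<in>carrier SL2C. B \<otimes>\<^bsub>SL2C\<^esub> A = \<one>\<^bsub>SL2C\<^esub>"
    using B by (auto simp: SL2C_def)
qed (auto simp: SL2C_def det_mul matrix_mul_assoc)

lemma matrix_mul_uminus:
  fixes A B :: "complex^2^2"
  shows "(- A) ** B = - (A ** B)" "A ** (- B) = - (A ** B)"
  by (simp_all add: matrix_matrix_mult_def vec_eq_iff sum_negf)

lemma SL2C_centre_normal: "SL2C_centre \<lhd> SL2C"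
proof -
  interpret group SL2C by (rule group_SL2C)
  have det: "det (- mat 1 :: complex^2^2) = 1"
    by (simp add: det_2 mat_def)
  have "subgroup SL2C_centre SL2C"
  proof (rule subgroupI)
    show "SL2C_centre \<subseteq> carrier SL2C"
      using det by (auto simp: SL2C_centre_def SL2C_def)
    fix A assume A: "A \<in> SL2C_centre"
    then have "A \<otimes>\<^bsub>SL2C\<^esub> A = \<one>\<^bsub>SL2C\<^esub>" "A \<in> carrier SL2C"
      using det by (auto simp: SL2C_centre_def SL2C_def matrix_mul_uminus)
    then show "inv\<^bsub>SL2C\<^esub> A \<in> SL2C_centre"
      using A inv_equality by metis
  qed (auto simp: SL2C_centre_def SL2C_def matrix_mul_uminus)
  then show ?thesis
    by (rule normalI)
      (auto simp: r_coset_def l_coset_def SL2C_centre_def SL2C_def matrix_mul_uminus)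
qed

lemma group_PSL2C: "group PSL2C"
  unfolding PSL2C_def by (rule normal.factorgroup_is_group[OF SL2C_centre_normal])

lemma carrier_PSL2C: "carrier PSL2C = PSL2C_proj ` carrier SL2C"
  by (simp add: PSL2C_def PSL2C_proj_def[abs_def] carrier_FactGroup)

lemma openin_PSL2C_topology:
  "openin PSL2C_topology U \<longleftrightarrow> U \<subseteq> carrier PSL2C \<and>
     openin (top_of_set (carrier SL2C)) {A \<in> carrier SL2C. PSL2C_proj A \<in> U}"
proof -
  let ?P = "\<lambda>U. {A \<in> carrier SL2C. PSL2C_proj A \<in> U}"
  have Int: "?P (S \<inter> T) = ?P S \<inter> ?P T" for S T by auto
  have Un: "?P (\<Union>K) = \<Union> (?P ` K)" for K by auto
  have "istopology (\<lambda>U. U \<subseteq> carrier PSL2C \<and> openin (top_of_set (carrier SL2C)) (?P U))"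
    unfolding istopology_def Int Un by (blast intro: openin_Int openin_Union)
  then show ?thesis
    by (simp add: PSL2C_topology_def)
qed

lemma topspace_PSL2C_topology: "topspace PSL2C_topology = carrier PSL2C"
proof -
  have "{A \<in> carrier SL2C. PSL2C_proj A \<in> carrier PSL2C} = carrier SL2C"
    by (auto simp: carrier_PSL2C)
  then have "openin PSL2C_topology (carrier PSL2C)"
    by (simp add: openin_PSL2C_topology)
  then show ?thesis
    by (meson openin_PSL2C_topology openin_subset openin_topspace subset_antisym)
qed

lemma quotient_map_PSL2C_proj:
  "quotient_map (top_of_set (carrier SL2C)) PSL2C_topology PSL2C_proj"
  by (simp add: quotient_map_def topspace_PSL2C_topology openin_PSL2C_topology carrier_PSL2C)

end

theory Submission
  imports Defs
begin

text \<open>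
  The reason is Cayley--Hamilton: a matrix \<open>B\<close> with \<open>det B = 1\<close> satisfies
  \<open>B\<^sup>2 = tr(B) B - 1\<close>. Suppose that \<open>h\<close> conjugates \<open>g\<close> to its inverse, and let \<open>B\<close> and \<open>A\<close> be
  lifts of \<open>h\<close> and \<open>g\<close>. Conjugation by \<open>h\<^sup>2\<close> fixes \<open>g\<close>, and the relation
  \<open>B A B\<inverse> = \<plusminus> A\<inverse>\<close> shows that \<open>B\<^sup>2\<close> commutes with \<open>A\<close> already in \<open>SL(2,\<complex>)\<close>, since the sign
  enters twice. If \<open>tr(B) = 0\<close>, then \<open>B\<^sup>2 = -1\<close>, so \<open>h\<close> is itself an involution. If
  \<open>tr(B) \<noteq> 0\<close>, then \<open>B\<close> is a linear combination of \<open>B\<^sup>2\<close> and \<open>1\<close>, so \<open>B\<close> commutes with \<open>A\<close>;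
  hence \<open>g = g\<inverse>\<close>, and the identity conjugates \<open>g\<close> to its inverse.

  In both cases the involution lies in every subgroup that contains \<open>h\<close>, so the equivalence passes
  from \<open>PSL(2,\<complex>)\<close> to \<open>\<Gamma>\<close>. The argument treats elliptic, parabolic and loxodromic elements
  uniformly, without a normal form for \<open>A\<close>.
\<close>

lemma Cayley_Hamilton_SL2C:
  fixes B :: "complex^2^2"
  assumes "det B = 1"
  shows "B ** B = mat (trace B) ** B - mat 1"
proof -
  have "B$1$1 * B$2$2 = 1 + B$1$2 * B$2$1"
    using assms by (simp add: det_2 algebra_simps)
  then show ?thesis
    by (simp add: vec_eq_iff forall_2 matrix_matrix_mult_def mat_def trace_def sum_2 algebra_simps)
qed

lemma mat_mult_commute:
  fixes A :: "complex^2^2"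
  shows "A ** mat c = mat c ** A"
  by (simp add: vec_eq_iff forall_2 matrix_matrix_mult_def mat_def sum_2)

lemma mat_mult_cancel:
  fixes X Y :: "complex^2^2"
  assumes "mat c ** X = mat c ** Y" and "c \<noteq> 0"
  shows "X = Y"
  using assms by (simp add: vec_eq_iff forall_2 matrix_matrix_mult_def mat_def sum_2)

lemma matrix_mul_diff_distrib:
  fixes A B C :: "complex^2^2"
  shows "A ** (B - C) = A ** B - A ** C" and "(B - C) ** A = B ** A - C ** A"
  by (simp_all add: vec_eq_iff matrix_matrix_mult_def sum_subtractf algebra_simps)

text \<open>A nonzero trace makes \<open>B\<close> a linear combination of \<open>B\<^sup>2\<close> and the identity matrix, so every
  matrix that commutes with \<open>B\<^sup>2\<close> commutes with \<open>B\<close>.\<close>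

lemma commute_if_square_commute_SL2C:
  fixes A B :: "complex^2^2"
  assumes det: "det B = 1" and tr: "trace B \<noteq> 0"
    and comm: "(B ** B) ** A = A ** (B ** B)"
  shows "B ** A = A ** B"
proof (rule mat_mult_cancel[OF _ tr])
  have "(mat (trace B) ** B - mat 1) ** A = A ** (mat (trace B) ** B - mat 1)"
    using comm unfolding Cayley_Hamilton_SL2C[OF det] .
  then have "mat (trace B) ** B ** A = A ** (mat (trace B) ** B)"
    by (simp add: matrix_mul_diff_distrib)
  then show "mat (trace B) ** (B ** A) = mat (trace B) ** (A ** B)"
    by (simp add: matrix_mul_assoc mat_mult_commute)
qed

lemma PSL2C_proj_eq: "PSL2C_proj A = {A, - A}"
  by (simp add: PSL2C_proj_def r_coset_def SL2C_centre_def SL2C_def matrix_mul_uminus insert_commute)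

lemma PSL2C_proj_eq_iff: "PSL2C_proj A = PSL2C_proj B \<longleftrightarrow> A = B \<or> A = - B"
  by (auto simp: PSL2C_proj_eq doubleton_eq_iff)

lemma PSL2C_proj_mult:
  assumes "det A = 1" and "det B = 1"
  shows "PSL2C_proj A \<otimes>\<^bsub>PSL2C\<^esub> PSL2C_proj B = PSL2C_proj (A ** B)"
proof -
  have "PSL2C_proj (A \<otimes>\<^bsub>SL2C\<^esub> B) = PSL2C_proj A \<otimes>\<^bsub>PSL2C\<^esub> PSL2C_proj B"
    using hom_mult[OF normal.r_coset_hom_Mod[OF SL2C_centre_normal], of A B] assms
    by (simp add: PSL2C_proj_def PSL2C_def SL2C_def)
  then show ?thesis by (simp add: SL2C_def)
qed

lemma PSL2C_one: "\<one>\<^bsub>PSL2C\<^esub> = PSL2C_proj (mat 1)"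
  by (simp add: PSL2C_def FactGroup_def PSL2C_proj_eq SL2C_centre_def)

text \<open>The relation \<open>h g h\<inverse> = g\<inverse>\<close> is used in the form \<open>g h g = h\<close>, which lifts to matrices without
  inverses and with a single sign.\<close>

lemma PSL2C_conjugates_to_inverse_cases:
  assumes h: "h \<in> carrier PSL2C" and g: "g \<in> carrier PSL2C"
    and rel: "g \<otimes>\<^bsub>PSL2C\<^esub> h \<otimes>\<^bsub>PSL2C\<^esub> g = h"
  shows "h \<otimes>\<^bsub>PSL2C\<^esub> h = \<one>\<^bsub>PSL2C\<^esub> \<or> g \<otimes>\<^bsub>PSL2C\<^esub> g = \<one>\<^bsub>PSL2C\<^esub>"
proof -
  obtain A where A: "det A = 1" "g = PSL2C_proj A"
    using g by (auto simp: carrier_PSL2C SL2C_def)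
  obtain B where B: "det B = 1" "h = PSL2C_proj B"
    using h by (auto simp: carrier_PSL2C SL2C_def)
  have ABA: "A ** B ** A = B \<or> A ** B ** A = - B"
    using rel A B by (simp add: PSL2C_proj_mult det_mul PSL2C_proj_eq_iff)
  show ?thesis
  proof (cases "trace B = 0")
    case True
    then have "B ** B = - mat 1"
      using Cayley_Hamilton_SL2C[OF B(1)] by (simp add: vec_eq_iff mat_def matrix_matrix_mult_def)
    then show ?thesis
      using B by (simp add: PSL2C_proj_mult PSL2C_one PSL2C_proj_eq_iff)
  next
    case False
    \<comment> \<open>Up to the common sign of \<open>A B A = \<plusminus> B\<close>, both sides equal \<open>A B A B A\<close>.\<close>
    have "(B ** B) ** A = A ** (B ** B)"
    proof -
      have "A ** (B ** (A ** B ** A)) = ((A ** B ** A) ** B) ** A"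
        by (simp add: matrix_mul_assoc)
      then show ?thesis
        using ABA by (auto simp: matrix_mul_uminus)
    qed
    then have BA: "B ** A = A ** B"
      by (rule commute_if_square_commute_SL2C[OF B(1) False])
    obtain C where C: "B ** C = mat 1"
      using B(1) by (metis invertible_def invertible_det_nz zero_neq_one)
    have "A ** B ** A = (A ** A) ** B"
      using BA by (metis matrix_mul_assoc)
    then have "(A ** A) ** (B ** C) = B ** C \<or> (A ** A) ** (B ** C) = - (B ** C)"
      using ABA by (metis matrix_mul_assoc matrix_mul_uminus(1))
    then have "A ** A = mat 1 \<or> A ** A = - mat 1"
      by (simp add: C)
    then show ?thesis
      using A by (simp add: PSL2C_proj_mult PSL2C_one PSL2C_proj_eq_iff)
  qed
qed

theorem proposition3p1:
  fixes \<Gamma> :: "(complex^2^2) set set" and g :: "(complex^2^2) set"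
  assumes "Kleinian_group \<Gamma>" and "g \<in> \<Gamma>"
  shows "reversible (PSL2C\<lparr>carrier := \<Gamma>\<rparr>) g \<longleftrightarrow> strongly_reversible (PSL2C\<lparr>carrier := \<Gamma>\<rparr>) g"
proof
  let ?G = "PSL2C\<lparr>carrier := \<Gamma>\<rparr>"
  have sub: "subgroup \<Gamma> PSL2C"
    using assms(1) by (simp add: Kleinian_group_def)
  interpret P: group PSL2C by (rule group_PSL2C)
  interpret G: group ?G by (rule P.subgroup_imp_group[OF sub])
  have g: "g \<in> carrier ?G" using assms(2) by simp
  assume "reversible ?G g"
  then obtain h where h: "h \<in> carrier ?G"
    and rev: "h \<otimes>\<^bsub>?G\<^esub> g \<otimes>\<^bsub>?G\<^esub> inv\<^bsub>?G\<^esub> h = inv\<^bsub>?G\<^esub> g"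
    by (auto simp: reversible_def)
  have "h \<otimes>\<^bsub>?G\<^esub> g = inv\<^bsub>?G\<^esub> g \<otimes>\<^bsub>?G\<^esub> h"
    using rev g h by (metis G.inv_closed G.inv_solve_right' G.m_closed)
  then have "g \<otimes>\<^bsub>?G\<^esub> (h \<otimes>\<^bsub>?G\<^esub> g) = h"
    using g h by (metis G.inv_closed G.inv_solve_left G.m_closed)
  then have rel: "g \<otimes>\<^bsub>?G\<^esub> h \<otimes>\<^bsub>?G\<^esub> g = h"
    using g h by (metis G.m_assoc)
  have "h \<otimes>\<^bsub>PSL2C\<^esub> h = \<one>\<^bsub>PSL2C\<^esub> \<or> g \<otimes>\<^bsub>PSL2C\<^esub> g = \<one>\<^bsub>PSL2C\<^esub>"
    using rel g h subgroup.subset[OF sub]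
    by (intro PSL2C_conjugates_to_inverse_cases) auto
  then have "h \<otimes>\<^bsub>?G\<^esub> h = \<one>\<^bsub>?G\<^esub> \<or> g \<otimes>\<^bsub>?G\<^esub> g = \<one>\<^bsub>?G\<^esub>"
    by simp
  then show "strongly_reversible ?G g"
  proof
    assume "h \<otimes>\<^bsub>?G\<^esub> h = \<one>\<^bsub>?G\<^esub>"
    then show ?thesis
      using g h rev by (auto simp: strongly_reversible_def involution_def)
  next
    assume "g \<otimes>\<^bsub>?G\<^esub> g = \<one>\<^bsub>?G\<^esub>"
    then have "inv\<^bsub>?G\<^esub> g = g"
      using g G.inv_equality by blast
    then have "\<one>\<^bsub>?G\<^esub> \<otimes>\<^bsub>?G\<^esub> g \<otimes>\<^bsub>?G\<^esub> inv\<^bsub>?G\<^esub> \<one>\<^bsub>?G\<^esub> = inv\<^bsub>?G\<^esub> g"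
      using g by (simp only: G.inv_one G.l_one G.r_one)
    moreover have "involution ?G \<one>\<^bsub>?G\<^esub>"
      using G.one_closed G.l_one unfolding involution_def by blast
    ultimately show ?thesis
      using g unfolding strongly_reversible_def by blast
  qed
next
  assume "strongly_reversible (PSL2C\<lparr>carrier := \<Gamma>\<rparr>) g"
  then show "reversible (PSL2C\<lparr>carrier := \<Gamma>\<rparr>) g"
    unfolding strongly_reversible_def reversible_def involution_def by blast
qed

end
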